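(* Consider the problem $$z^*=\inf\{\, f_0(x) : x\in F\cap P\,\},\quad F=\{x\in\mathbb{R}^n: f_1(x)\le0,\ f_2(x)\le 0\},\quad P=\{x\in\mathbb{R}^n: Bx\le b\},$$ with $f_0(x)=x^\top Q_0x+2q_0^\top x$, $f_1(x)=x^\top Q_1x+2q_1^\top x-1$, $f_2(x)=\|Ax-a\|^2-1$. If $(\bar x;\bar u,\bar v)\in(F\cap P)\times\mathbb{R}^3_+\times\mathbb{R}^p$ is a generalized KKT pair of this problem such that $$\bar S:=M(L(\cdot;\bar u,0))-f_0(\bar x)J_0\quad\text{is }\Upsilon\text{-copositive},$$ where $\Upsilon=\mathbb{R}^{p+1}_+\times\mathbb{R}^n$, then $\bar x$ is a globally optimal solution to the problem and $z^*=z^*_{\rm COP}$, where $z^*_{\rm COP}$ is the optimal value of its copositive relaxation.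
   Context: Data: $Q_0,Q_1$ are real symmetric $n\times n$ matrices, $A$ is a real $\ell\times n$ matrix, $B$ is a real $p\times n$ matrix, $a\in\mathbb{R}^\ell$, $b\in\mathbb{R}^p$, $q_0,q_1\in\mathbb{R}^n$; norms are Euclidean and $Bx\le b$ is componentwise. For $y=(s,x)\in\mathbb{R}^p\times\mathbb{R}^n$ put $\bar f_i(y)=f_i(x)$ for $i=0,1,2$ and $\bar f_3(y)=\|Bx+s-b\|^2$. Lagrangian: for $u\in\mathbb{R}^3_+$, $v\in\mathbb{R}^p$, let $L(y;u,v)=\bar f_0(y)+\sum_{i=1}^3u_i\bar f_i(y)-v^\top s$. Generalized KKT pair: $(x;u,v)\in(F\cap P)\times\mathbb{R}^3_+\times\mathbb{R}^p$ is a generalized KKT pair if, with $s=b-Bx$ and $y=(s,x)$, one has $\nabla_yL(y;u,v)=0$, $v_ks_k=0$ for all $k=1,\dots,p$, and $u_i\bar f_i(y)=0$ for $i=1,2,3$ (the condition $v_k\ge0$ is not required). Shor matrix: for a quadratic function $q(y)=y^\top Hy-2d^\top y+\gamma$ on $\mathbb{R}^N$ ($H$ symmetric), $M(q)=\begin{bmatrix}\gamma&-d^\top\\-d&H\end{bmatrix}$. $J_0$ denotes the matrix of order $p+n+1$ whose $(1,1)$ entry is $1$ and all of whose other entries are $0$. Copositivity: a symmetric matrix $Q$ of order $p+n+1$ is $\Upsilon$-copositive if $w^\top Qw\ge0$ for all $w\in\Upsilon=\mathbb{R}^{p+1}_+\times\mathbb{R}^n$. Copositive relaxation value: $z^*_{\rm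 COP}=\sup\{\mu : (\mu,u)\in\mathbb{R}\times\mathbb{R}^3_+,\ M(L(\cdot;u,0))-\mu J_0\ \text{is}\ \Upsilon\text{-copositive}\}$, with $\sup\emptyset=-\infty$. *)

theory Defs
  imports "HOL-Analysis.Analysis"
begin

text \<open>
  A point \<open>y = (s, x)\<close> of \<open>\<real>\<^sup>p \<times> \<real>\<^sup>n\<close> is a vector indexed by the sum type
  \<open>'p + 'n\<close>. Matrices and vectors of order \<open>N + 1\<close> are indexed by \<open>'N option\<close>, where
  \<open>None\<close> is the first (homogenizing) index.
\<close>

definition join :: "real ^ 'p \<Rightarrow> real ^ 'n \<Rightarrow> real ^ ('p + 'n)" where
  "join s x = (\<chi> i. case i of Inl k \<Rightarrow> s $ k | Inr j \<Rightarrow> x $ j)"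

definition s_part :: "real ^ ('p::finite + 'n::finite) \<Rightarrow> real ^ 'p" where
  "s_part y = (\<chi> k. y $ Inl k)"

definition x_part :: "real ^ ('p::finite + 'n::finite) \<Rightarrow> real ^ 'n" where
  "x_part y = (\<chi> j. y $ Inr j)"

definition feasible_set ::
  "(real ^ 'n \<Rightarrow> real) \<Rightarrow> (real ^ 'n \<Rightarrow> real) \<Rightarrow> real ^ 'n ^ 'p \<Rightarrow> real ^ 'p \<Rightarrow> (real ^ 'n) set"
  where
  "feasible_set f1 f2 B b = {x. f1 x \<le> 0 \<and> f2 x \<le> 0} \<inter> {x. B *v x \<le> b}"

definition f3bar :: "real ^ 'n ^ 'p \<Rightarrow> real ^ 'p \<Rightarrow> real ^ ('p + 'n) \<Rightarrow> real" where
  "f3bar B b y = (norm (B *v x_part y + s_part y - b))\<^sup>2"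

definition lagrangian ::
  "(real ^ 'n \<Rightarrow> real) \<Rightarrow> (real ^ 'n \<Rightarrow> real) \<Rightarrow> (real ^ 'n \<Rightarrow> real) \<Rightarrow> real ^ 'n ^ 'p \<Rightarrow> real ^ 'p
    \<Rightarrow> real ^ ('p + 'n) \<Rightarrow> real ^ 3 \<Rightarrow> real ^ 'p \<Rightarrow> real" where
  "lagrangian f0 f1 f2 B b y u v =
     f0 (x_part y) + (u $ 1 * f1 (x_part y) + u $ 2 * f2 (x_part y) + u $ 3 * f3bar B b y)
       - v \<bullet> s_part y"

text \<open>
  No sign condition is imposed on \<open>v\<close>. The condition \<open>GDERIV f y :> 0\<close> says that \<open>f\<close> is
  differentiable at \<open>y\<close> with gradient \<open>0\<close>.
\<close>

definition generalized_KKT_pair ::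
  "(real ^ 'n \<Rightarrow> real) \<Rightarrow> (real ^ 'n \<Rightarrow> real) \<Rightarrow> (real ^ 'n \<Rightarrow> real) \<Rightarrow> real ^ 'n ^ 'p \<Rightarrow> real ^ 'p
    \<Rightarrow> real ^ 'n \<Rightarrow> real ^ 3 \<Rightarrow> real ^ 'p \<Rightarrow> bool" where
  "generalized_KKT_pair f0 f1 f2 B b x u v \<longleftrightarrow>
     x \<in> feasible_set f1 f2 B b \<and> 0 \<le> u \<and>
     (let s = b - B *v x; y = join s x in
        GDERIV (\<lambda>y. lagrangian f0 f1 f2 B b y u v) y :> 0 \<and>
        (\<forall>k. v $ k * s $ k = 0) \<and>
        u $ 1 * f1 (x_part y) = 0 \<and> u $ 2 * f2 (x_part y) = 0 \<and> u $ 3 * f3bar B b y = 0)"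

definition block_matrix ::
  "real \<Rightarrow> real ^ 'N \<Rightarrow> real ^ 'N ^ 'N \<Rightarrow> real ^ ('N option) ^ ('N option)" where
  "block_matrix \<gamma> d H =
     (\<chi> i j. case i of
        None \<Rightarrow> (case j of None \<Rightarrow> \<gamma> | Some l \<Rightarrow> - d $ l)
      | Some k \<Rightarrow> (case j of None \<Rightarrow> - d $ k | Some l \<Rightarrow> H $ k $ l))"

definition quadratic_rep ::
  "(real ^ 'N \<Rightarrow> real) \<Rightarrow> real \<Rightarrow> real ^ 'N \<Rightarrow> real ^ 'N ^ 'N \<Rightarrow> bool" where
  "quadratic_rep q \<gamma> d H \<longleftrightarrow>
     transpose H = H \<and> (\<forall>y. q y = y \<bullet> (H *v y) - 2 * (d \<bullet> y) + \<gamma>)"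

text \<open>
  The coefficients of a quadratic function are determined by the function; see
  \<open>shor_matrix_eq\<close> below. On functions that are not quadratic the value is unspecified.
\<close>

definition shor_matrix :: "(real ^ 'N \<Rightarrow> real) \<Rightarrow> real ^ ('N option) ^ ('N option)" where
  "shor_matrix q = (THE M. \<exists>\<gamma> d H. quadratic_rep q \<gamma> d H \<and> M = block_matrix \<gamma> d H)"

lemma quadratic_rep_unique:
  fixes q :: "real ^ 'N \<Rightarrow> real"
  assumes "quadratic_rep q \<gamma> d H" "quadratic_rep q \<gamma>' d' H'"
  shows "\<gamma> = \<gamma>' \<and> d = d' \<and> H = H'"
proof -
  have e: "y \<bullet> (H *v y) - 2 * (d \<bullet> y) + \<gamma> = y \<bullet> (H' *v y) - 2 * (d' \<bullet> y) + \<gamma>'" for y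
    using assms unfolding quadratic_rep_def by metis
  have g: "\<gamma> = \<gamma>'"
    using e[of 0] by simp
  have neg: "K *v (- y) = - (K *v y)" for K :: "real ^ 'N ^ 'N" and y
    by (rule linear_neg[OF matrix_vector_mul_linear])
  have lin: "d \<bullet> y = d' \<bullet> y" and quad: "y \<bullet> (H *v y) = y \<bullet> (H' *v y)" for y
    using e[of y] e[of "- y"] g neg[of H y] neg[of H' y] by simp_all
  have d: "d = d'"
    using lin by (metis inner_commute vector_eq_ldot)
  have sym: "x \<bullet> (K *v y) = y \<bullet> (K *v x)" if "transpose K = K" for x y and K :: "real ^ 'N ^ 'N"
    using that by (metis dot_lmul_matrix inner_commute transpose_matrix_vector)
  have "x \<bullet> (H *v y) = x \<bullet> (H' *v y)" for x y
    using quad[of "x + y"] quad[of x] quad[of y] assms sym[of H x y] sym[of H' x y]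
    unfolding quadratic_rep_def
    by (simp add: matrix_vector_right_distrib inner_add_left inner_add_right)
  then have "H *v y = H' *v y" for y
    by (metis vector_eq_ldot)
  then show ?thesis
    using g d by (simp add: matrix_eq)
qed

lemma shor_matrix_eq:
  assumes "quadratic_rep q \<gamma> d H"
  shows "shor_matrix q = block_matrix \<gamma> d H"
  unfolding shor_matrix_def
  by (rule the_equality) (use assms quadratic_rep_unique in blast)+

definition J0 :: "real ^ ('N::finite option) ^ ('N option)" where
  "J0 = (\<chi> i j. if i = None \<and> j = None then 1 else 0)"

definition Upsilon :: "(real ^ (('p::finite + 'n::finite) option)) set" where
  "Upsilon = {w. 0 \<le> w $ None \<and> (\<forall>k. 0 \<le> w $ Some (Inl k))}"

definition Upsilon_copositive ::
  "real ^ (('p::finite + 'n::finite) option) ^ (('p + 'n) option) \<Rightarrow> bool" where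
  "Upsilon_copositive Q \<longleftrightarrow> transpose Q = Q \<and> (\<forall>w\<in>Upsilon. 0 \<le> w \<bullet> (Q *v w))"

definition z_star ::
  "(real ^ 'n \<Rightarrow> real) \<Rightarrow> (real ^ 'n \<Rightarrow> real) \<Rightarrow> (real ^ 'n \<Rightarrow> real) \<Rightarrow> real ^ 'n ^ 'p \<Rightarrow> real ^ 'p
    \<Rightarrow> ereal" where
  "z_star f0 f1 f2 B b = (INF x \<in> feasible_set f1 f2 B b. ereal (f0 x))"

definition z_COP ::
  "(real ^ 'n \<Rightarrow> real) \<Rightarrow> (real ^ 'n \<Rightarrow> real) \<Rightarrow> (real ^ 'n \<Rightarrow> real) \<Rightarrow> real ^ 'n ^ 'p \<Rightarrow> real ^ 'p
    \<Rightarrow> ereal" where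
  "z_COP f0 f1 f2 B b =
     Sup {ereal \<mu> | \<mu> u. 0 \<le> (u :: real ^ 3) \<and>
       Upsilon_copositive (shor_matrix (\<lambda>y. lagrangian f0 f1 f2 B b y u 0) - \<mu> *\<^sub>R J0)}"

end

theory Submission
  imports Defs
begin

text \<open>
  Weak duality. Evaluating the Shor form at the homogenized vector \<open>(1, s, x)\<close> with \<open>s = b - B x \<ge> 0\<close>
  turns copositivity of \<open>M(L(\<cdot>;u,0)) - \<mu> J\<^sub>0\<close> into
  \<open>\<mu> \<le> L(s, x; u, 0) = f\<^sub>0(x) + u\<^sub>1 f\<^sub>1(x) + u\<^sub>2 f\<^sub>2(x) \<le> f\<^sub>0(x)\<close> for every feasible \<open>x\<close>, and the
  hypothesis says that \<open>(\<mu>, u) = (f\<^sub>0(xbar), ubar)\<close> is admissible in the copositive relaxation.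
\<close>

text \<open>Riesz representation in the first argument: for fixed \<open>y\<close>, the functional
  \<open>x\<close> to \<open>\<beta> x y\<close> is the inner product with its adjoint applied to
  the real number 1. Testing against all \<open>x\<close> shows that this vector depends linearly on
  \<open>y\<close>, so a matrix produces it.\<close>

lemma bilinear_matrix_representation:
  fixes \<beta> :: "real ^ 'N \<Rightarrow> real ^ 'N \<Rightarrow> real"
  assumes "bilinear \<beta>"
  obtains K where "\<And>x y. \<beta> x y = x \<bullet> (K *v y)"
proof -
  define T where "T = (\<lambda>y. adjoint (\<lambda>x. \<beta> x y) 1)"
  have T: "x \<bullet> T y = \<beta> x y" for x y
  proof -
    have "linear (\<lambda>x. \<beta> x y)"
      using assms by (simp add: bilinear_def)
    then show ?thesis
      unfolding T_def by (subst adjoint_works) simp_all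
  qed
  have "T (y + z) = T y + T z" for y z
    by (subst vector_eq_ldot[symmetric]) (simp add: T inner_add_right bilinear_radd[OF assms])
  moreover have "T (c *\<^sub>R y) = c *\<^sub>R T y" for c y
    by (subst vector_eq_ldot[symmetric]) (simp add: T bilinear_rmul[OF assms])
  ultimately have "linear T"
    by (simp add: linear_iff)
  then have "\<beta> x y = x \<bullet> (matrix T *v y)" for x y
    by (simp add: T matrix_works)
  then show ?thesis
    by (rule that)
qed

text \<open>Recognizes a quadratic function without computing its coefficients. The form
  \<open>\<beta>\<close> may be asymmetric: \<open>K\<close> and its transpose have the same
  quadratic form, so their average is a symmetric choice.\<close>

lemma quadratic_rep_exists:
  fixes q :: "real ^ 'N \<Rightarrow> real"
  assumes \<beta>: "bilinear \<beta>" and l: "linear l" and q: "\<And>y. q y = \<beta> y y + l y + \<gamma>"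
  shows "\<exists>d H. quadratic_rep q \<gamma> d H"
proof -
  obtain K where K: "\<And>x y. \<beta> x y = x \<bullet> (K *v y)"
    using bilinear_matrix_representation[OF \<beta>] by blast
  define H where "H = (1/2) *\<^sub>R (K + transpose K)"
  \<comment> \<open>\<open>adjoint l 1\<close> is the Riesz vector of \<open>l\<close>; the factor
    -1/2 matches the convention that the linear term of \<open>quadratic_rep\<close> is -2 times the
    inner product with \<open>d\<close>.\<close>
  define d where "d = - (1/2) *\<^sub>R adjoint l 1"
  have "transpose H = H"
    by (simp add: H_def vec_eq_iff transpose_def add.commute)
  moreover have "y \<bullet> (H *v y) = \<beta> y y" for y
  proof -
    have "y \<bullet> (transpose K *v y) = y \<bullet> (K *v y)"
      by (metis dot_lmul_matrix inner_commute transpose_matrix_vector)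
    then show ?thesis
      by (simp add: H_def K matrix_vector_mult_add_rdistrib scaleR_matrix_vector_assoc[symmetric]
          inner_add_right)
  qed
  moreover have "2 * (d \<bullet> y) = - l y" for y
    using adjoint_works[OF l, of y 1] by (simp add: d_def inner_commute)
  ultimately have "quadratic_rep q \<gamma> d H"
    by (simp add: quadratic_rep_def q)
  then show ?thesis
    by blast
qed

definition homogenize :: "real ^ 'N \<Rightarrow> real ^ ('N option)" where
  "homogenize y = (\<chi> i. case i of None \<Rightarrow> 1 | Some k \<Rightarrow> y $ k)"

lemma sum_UNIV_option:
  fixes g :: "'a::finite option \<Rightarrow> 'b::comm_monoid_add"
  shows "sum g UNIV = g None + (\<Sum>k\<in>UNIV. g (Some k))"
  by (simp add: UNIV_option_conv sum.reindex)

lemma homogenize_block_matrix: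
  "homogenize y \<bullet> (block_matrix \<gamma> d H *v homogenize y) = y \<bullet> (H *v y) - 2 * (d \<bullet> y) + \<gamma>"
  by (simp add: inner_vec_def matrix_vector_mult_def homogenize_def block_matrix_def
      sum_UNIV_option sum.distrib sum_negf algebra_simps)

lemma homogenize_J0: "homogenize y \<bullet> (J0 *v homogenize y) = 1"
  by (simp add: inner_vec_def matrix_vector_mult_def homogenize_def J0_def sum_UNIV_option)

text \<open>At a vector with first entry 1 the Shor form returns the value of \<open>q\<close>,
  while \<open>J0\<close> sees only that entry and contributes 1.\<close>

lemma homogenize_shor_matrix:
  assumes "quadratic_rep q \<gamma> d H"
  shows "homogenize y \<bullet> ((shor_matrix q - \<mu> *\<^sub>R J0) *v homogenize y) = q y - \<mu>"
  using assms
  by (simp add: shor_matrix_eq[OF assms] matrix_vector_mult_diff_rdistrib inner_diff_right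
      scaleR_matrix_vector_assoc[symmetric] homogenize_block_matrix homogenize_J0
      quadratic_rep_def)

lemma homogenize_in_Upsilon: "0 \<le> s_part y \<Longrightarrow> homogenize y \<in> Upsilon"
  by (simp add: Upsilon_def homogenize_def s_part_def less_eq_vec_def)

lemma s_part_join [simp]: "s_part (join s x) = s"
  by (simp add: s_part_def join_def vec_eq_iff)

lemma x_part_join [simp]: "x_part (join s x) = x"
  by (simp add: x_part_def join_def vec_eq_iff)

lemma linear_s_part: "linear s_part"
  by (simp add: linear_iff s_part_def vec_eq_iff)

lemma linear_x_part: "linear x_part"
  by (simp add: linear_iff x_part_def vec_eq_iff)

lemma bilinear_inner_linear:
  fixes g h :: "'a::real_vector \<Rightarrow> 'b::real_inner"
  assumes "linear g" "linear h"
  shows "bilinear (\<lambda>y z. g y \<bullet> h z)"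
  using assms by (simp add: bilinear_def linear_iff inner_add_left inner_add_right)

lemma bilinear_add:
  "bilinear \<beta> \<Longrightarrow> bilinear \<beta>' \<Longrightarrow> bilinear (\<lambda>y z. \<beta> y z + \<beta>' y z)"
  by (simp add: bilinear_def linear_compose_add)

lemma bilinear_mult_const:
  fixes \<beta> :: "'a::real_vector \<Rightarrow> 'b::real_vector \<Rightarrow> real"
  shows "bilinear \<beta> \<Longrightarrow> bilinear (\<lambda>y z. c * \<beta> y z)"
  by (simp add: bilinear_def linear_iff algebra_simps)

text \<open>\<open>shor_matrix\<close> is a definite description, so its value at the Lagrangian
  becomes known only through such a representation. It comes from expanding the squared norms of
  affine maps in \<open>f2\<close> and \<open>f3bar\<close> and sorting the terms by degree.\<close>

lemma lagrangian_quadratic_rep: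
  fixes Q0 Q1 :: "real ^ 'n ^ 'n" and A :: "real ^ 'n ^ 'l" and B :: "real ^ 'n ^ 'p"
  assumes f0: "f0 = (\<lambda>x. x \<bullet> (Q0 *v x) + 2 * (q0 \<bullet> x))"
    and f1: "f1 = (\<lambda>x. x \<bullet> (Q1 *v x) + 2 * (q1 \<bullet> x) - 1)"
    and f2: "f2 = (\<lambda>x. (norm (A *v x - a))\<^sup>2 - 1)"
  shows "\<exists>\<gamma> d H. quadratic_rep (\<lambda>y. lagrangian f0 f1 f2 B b y u v) \<gamma> d H"
proof -
  \<comment> \<open>The linear part of the residual: \<open>f3bar B b y\<close> is the squared norm
    of \<open>g y - b\<close>, which splits into the last terms of \<open>\<beta>\<close>,
    \<open>l\<close> (before the \<open>v\<close> term) and \<open>\<gamma>\<close>.\<close>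
  define g where "g = (\<lambda>y :: real ^ ('p + 'n). B *v x_part y + s_part y)"
  define \<beta> where "\<beta> = (\<lambda>y z :: real ^ ('p + 'n). x_part y \<bullet> (Q0 *v x_part z)
      + u $ 1 * (x_part y \<bullet> (Q1 *v x_part z)) + u $ 2 * ((A *v x_part y) \<bullet> (A *v x_part z))
      + u $ 3 * (g y \<bullet> g z))"
  define l where "l = (\<lambda>y. 2 * (q0 \<bullet> x_part y) + u $ 1 * (2 * (q1 \<bullet> x_part y))
      - u $ 2 * (2 * (a \<bullet> (A *v x_part y))) - u $ 3 * (2 * (b \<bullet> g y)) - v \<bullet> s_part y)"
  define \<gamma> where "\<gamma> = - u $ 1 + u $ 2 * (a \<bullet> a - 1) + u $ 3 * (b \<bullet> b)"
  have lin: "linear (\<lambda>y. C *v x_part y)" for C :: "real ^ 'n ^ 'm"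
    using linear_compose[OF linear_x_part matrix_vector_mul_linear] by (simp add: o_def)
  have g: "linear g"
    unfolding g_def by (intro linear_compose_add lin linear_s_part)
  have "bilinear \<beta>"
    unfolding \<beta>_def
    by (intro bilinear_add bilinear_mult_const bilinear_inner_linear lin linear_x_part g)
  moreover have "linear l"
    unfolding l_def
    by (intro linearI) (simp_all add: linear_add[OF g] linear_scale[OF g] linear_add[OF lin]
        linear_scale[OF lin] linear_add[OF linear_x_part] linear_scale[OF linear_x_part]
        linear_add[OF linear_s_part] linear_scale[OF linear_s_part] inner_add_right algebra_simps)
  moreover have "lagrangian f0 f1 f2 B b y u v = \<beta> y y + l y + \<gamma>" for y
    by (simp add: lagrangian_def f3bar_def f0 f1 f2 g_def \<beta>_def l_def \<gamma>_def
        power2_norm_eq_inner inner_diff_left inner_diff_right inner_commute algebra_simps)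
  ultimately have "\<exists>d H. quadratic_rep (\<lambda>y. lagrangian f0 f1 f2 B b y u v) \<gamma> d H"
    by (rule quadratic_rep_exists)
  then show ?thesis
    by blast
qed

lemma copositive_weak_duality:
  assumes rep: "quadratic_rep (\<lambda>y. lagrangian f0 f1 f2 B b y u 0) \<gamma> d H"
    and u: "0 \<le> u"
    and cop: "Upsilon_copositive (shor_matrix (\<lambda>y. lagrangian f0 f1 f2 B b y u 0) - \<mu> *\<^sub>R J0)"
    and x: "x \<in> feasible_set f1 f2 B b"
  shows "\<mu> \<le> f0 x"
proof -
  \<comment> \<open>With this slack the residual in \<open>f3bar\<close> vanishes, so the third
    multiplier contributes nothing, and \<open>B *v x \<le> b\<close> says exactly that the slack is
    nonnegative.\<close>
  define y where "y = join (b - B *v x) x"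
  have "0 \<le> s_part y"
    using x by (simp add: y_def feasible_set_def)
  then have "\<mu> \<le> lagrangian f0 f1 f2 B b y u 0"
    using cop homogenize_in_Upsilon[of y] homogenize_shor_matrix[OF rep, of y \<mu>]
    unfolding Upsilon_copositive_def by fastforce
  also have "\<dots> = f0 x + (u $ 1 * f1 x + u $ 2 * f2 x)"
    by (simp add: lagrangian_def f3bar_def y_def)
  also have "\<dots> \<le> f0 x"
    using x u by (simp add: feasible_set_def less_eq_vec_def add_nonpos_nonpos mult_nonneg_nonpos)
  finally show ?thesis .
qed

theorem theorem4p2:
  fixes Q0 Q1 :: "real ^ 'n ^ 'n"
    and q0 q1 :: "real ^ 'n"
    and A :: "real ^ 'n ^ 'l"
    and a :: "real ^ 'l"
    and B :: "real ^ 'n ^ 'p"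
    and b :: "real ^ 'p"
    and f0 f1 f2 :: "real ^ 'n \<Rightarrow> real"
    and xbar :: "real ^ 'n"
    and ubar :: "real ^ 3"
    and vbar :: "real ^ 'p"
  assumes "transpose Q0 = Q0"
    and "transpose Q1 = Q1"
    and "f0 = (\<lambda>x. x \<bullet> (Q0 *v x) + 2 * (q0 \<bullet> x))"
    and "f1 = (\<lambda>x. x \<bullet> (Q1 *v x) + 2 * (q1 \<bullet> x) - 1)"
    and "f2 = (\<lambda>x. (norm (A *v x - a))\<^sup>2 - 1)"
    and "generalized_KKT_pair f0 f1 f2 B b xbar ubar vbar"
    and "Upsilon_copositive
           (shor_matrix (\<lambda>y. lagrangian f0 f1 f2 B b y ubar 0) - f0 xbar *\<^sub>R J0)"
  shows "xbar \<in> feasible_set f1 f2 B b \<and> (\<forall>x \<in> feasible_set f1 f2 B b. f0 xbar \<le> f0 x) \<and>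
         z_star f0 f1 f2 B b = z_COP f0 f1 f2 B b"
proof -
  let ?X = "feasible_set f1 f2 B b"
  have weak: "\<mu> \<le> f0 x"
    if "0 \<le> u" "Upsilon_copositive (shor_matrix (\<lambda>y. lagrangian f0 f1 f2 B b y u 0) - \<mu> *\<^sub>R J0)"
      "x \<in> ?X" for \<mu> u x
    using lagrangian_quadratic_rep[OF assms(3-5)] copositive_weak_duality that by metis
  have xbar: "xbar \<in> ?X" and ubar: "0 \<le> ubar"
    using assms(6) by (simp_all add: generalized_KKT_pair_def)
  have opt: "\<forall>x \<in> ?X. f0 xbar \<le> f0 x"
    using weak ubar assms(7) by blast
  \<comment> \<open>The value \<open>f0 xbar\<close> separates the two optima: \<open>xbar\<close>
    is a candidate for the infimum, and \<open>f0 xbar\<close> with multiplier \<open>ubar\<close>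
    is a candidate for the supremum.\<close>
  have "z_star f0 f1 f2 B b \<le> ereal (f0 xbar)"
    unfolding z_star_def by (rule INF_lower[OF xbar])
  also have "\<dots> \<le> z_COP f0 f1 f2 B b"
    unfolding z_COP_def by (rule Sup_upper) (use ubar assms(7) in blast)
  finally have "z_star f0 f1 f2 B b \<le> z_COP f0 f1 f2 B b" .
  \<comment> \<open>Conversely, \<open>weak\<close> places every admissible \<open>\<mu>\<close>
    below every feasible objective value, whatever its multiplier.\<close>
  moreover have "z_COP f0 f1 f2 B b \<le> z_star f0 f1 f2 B b"
    unfolding z_COP_def z_star_def by (intro Sup_least INF_greatest) (use weak in auto)
  ultimately show ?thesis
    using xbar opt by simp
qed

end
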